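(* Let $\mathbb{F}$ be a field. Two almost Abelian Lie algebras $\mathbf{L}=\mathbf{V}\rtimes\mathbb{F}e_0$ and $\mathbf{L}'=\mathbf{V}'\rtimes\mathbb{F}e_0'$ over $\mathbb{F}$ are isomorphic if and only if $(\mathbf{V},\mathrm{ad}_{e_0})\sim(\mathbf{V}',\lambda\,\mathrm{ad}_{e_0'})$ for some $\lambda\in\mathbb{F}^*$.
   Context: An almost Abelian Lie algebra over a field $\mathbb{F}$ (of arbitrary, possibly infinite, dimension) is a non-Abelian Lie algebra that contains a codimension 1 Abelian subalgebra; it then has a codimension 1 Abelian ideal. Writing $\mathbf{L}=\mathbf{V}\rtimes\mathbb{F}e_0$ means: $\mathbf{V}\subset\mathbf{L}$ is a codimension 1 Abelian ideal, $e_0\in\mathbf{L}\setminus\mathbf{V}$, and $\mathbf{L}=\mathbf{V}\oplus\mathbb{F}e_0$ as vector spaces. The operator $\mathrm{ad}_{e_0}\in\mathrm{End}_{\mathbb{F}}(\mathbf{V})$ is $v\mapsto[e_0,v]$; it is nonzero. Similarly for $\mathbf{L}'=\mathbf{V}'\rtimes\mathbb{F}e_0'$ and $\mathrm{ad}_{e_0'}\in\mathrm{End}_{\mathbb{F}}(\mathbf{V}')$. For vector spaces $\mathbf{V}_1,\mathbf{V}_2$ and operators $T_1\in\mathrm{End}_{\mathbb{F}}(\mathbf{V}_1)$, $T_2\in\mathrm{End}_{\mathbb{F}}(\mathbf{V}_2)$, the pairs are called similar, $(\mathbf{V}_1,T_1)\sim(\mathbf{V}_2,T_2)$, if there exists an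 invertible linear map $\phi:\mathbf{V}_1\to\mathbf{V}_2$ such that $\phi T_1=T_2\phi$. $\mathbb{F}^*=\mathbb{F}\setminus\{0\}$. *)

theory Defs
  imports Complex_Main
begin

definition linear_on ::
    "('k::field \<Rightarrow> 'a::ab_group_add \<Rightarrow> 'a) \<Rightarrow> ('k \<Rightarrow> 'b::ab_group_add \<Rightarrow> 'b) \<Rightarrow> 'a set \<Rightarrow> ('a \<Rightarrow> 'b) \<Rightarrow> bool"
  where "linear_on s1 s2 V f \<longleftrightarrow>
    (\<forall>x\<in>V. \<forall>y\<in>V. f (x + y) = f x + f y) \<and>
    (\<forall>c. \<forall>x\<in>V. f (s1 c x) = s2 c (f x))"

text \<open>Operators on a subspace are represented by functions on the ambient type; only their
  values on the subspace matter. In the intended use \<open>V\<^sub>i\<close> is a subspace and \<open>T\<^sub>i\<close> restricts to a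
  linear map from \<open>V\<^sub>i\<close> to itself (see \<open>ad_endomorphism\<close> below).\<close>

definition similar_operators ::
    "('k::field \<Rightarrow> 'a::ab_group_add \<Rightarrow> 'a) \<Rightarrow> 'a set \<Rightarrow> ('a \<Rightarrow> 'a) \<Rightarrow>
     ('k \<Rightarrow> 'b::ab_group_add \<Rightarrow> 'b) \<Rightarrow> 'b set \<Rightarrow> ('b \<Rightarrow> 'b) \<Rightarrow> bool"
  where "similar_operators s1 V1 T1 s2 V2 T2 \<longleftrightarrow>
    (\<exists>\<phi>. linear_on s1 s2 V1 \<phi> \<and> bij_betw \<phi> V1 V2 \<and> (\<forall>v\<in>V1. \<phi> (T1 v) = T2 (\<phi> v)))"

locale lie_algebra = vector_space scale
  for scale :: "'k::field \<Rightarrow> 'l::ab_group_add \<Rightarrow> 'l" +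
  fixes bracket :: "'l \<Rightarrow> 'l \<Rightarrow> 'l"
  assumes bracket_add_left: "bracket (x + y) z = bracket x z + bracket y z"
    and bracket_add_right: "bracket x (y + z) = bracket x y + bracket x z"
    and bracket_scale_left: "bracket (scale c x) y = scale c (bracket x y)"
    and bracket_scale_right: "bracket x (scale c y) = scale c (bracket x y)"
    and bracket_self: "bracket x x = 0"
    and jacobi: "bracket x (bracket y z) + bracket y (bracket z x) + bracket z (bracket x y) = 0"
begin

definition direct_sum_decomposition :: "'l set \<Rightarrow> 'l set \<Rightarrow> bool"
  where "direct_sum_decomposition V W \<longleftrightarrow>
    subspace V \<and> subspace W \<and> V \<inter> W = {0} \<and> {v + w | v w. v \<in> V \<and> w \<in> W} = UNIV"

text \<open>Codimension 1 is expressed by a one-dimensional complement, since the ambient space may be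
  infinite-dimensional. The library's \<open>dim\<close> is 0 for infinite-dimensional sets, so \<open>dim W = 1\<close>
  is unambiguous.\<close>

definition codimension_one :: "'l set \<Rightarrow> bool"
  where "codimension_one V \<longleftrightarrow> (\<exists>W. direct_sum_decomposition V W \<and> dim W = 1)"

definition lie_subalgebra :: "'l set \<Rightarrow> bool"
  where "lie_subalgebra V \<longleftrightarrow> subspace V \<and> (\<forall>x\<in>V. \<forall>y\<in>V. bracket x y \<in> V)"

definition lie_ideal :: "'l set \<Rightarrow> bool"
  where "lie_ideal V \<longleftrightarrow> subspace V \<and> (\<forall>x. \<forall>v\<in>V. bracket x v \<in> V)"

definition abelian :: "'l set \<Rightarrow> bool"
  where "abelian V \<longleftrightarrow> (\<forall>x\<in>V. \<forall>y\<in>V. bracket x y = 0)"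

definition ad :: "'l \<Rightarrow> 'l \<Rightarrow> 'l"
  where "ad x = (\<lambda>v. bracket x v)"

definition semidirect_decomposition :: "'l set \<Rightarrow> 'l \<Rightarrow> bool"
  where "semidirect_decomposition V e \<longleftrightarrow>
    lie_ideal V \<and> abelian V \<and> codimension_one V \<and> e \<notin> V \<and> direct_sum_decomposition V (span {e})"

lemma ad_endomorphism:
  assumes "lie_ideal V"
  shows "linear_on scale scale V (ad x)" and "ad x ` V \<subseteq> V"
  using assms
  by (auto simp: lie_ideal_def linear_on_def ad_def bracket_add_right bracket_scale_right)

end

locale almost_abelian_lie_algebra = lie_algebra scale bracket
  for scale :: "'k::field \<Rightarrow> 'l::ab_group_add \<Rightarrow> 'l" and bracket :: "'l \<Rightarrow> 'l \<Rightarrow> 'l" +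
  assumes non_abelian: "\<not> abelian UNIV"
    and ex_abelian_subalgebra: "\<exists>V. lie_subalgebra V \<and> abelian V \<and> codimension_one V"

definition lie_isomorphic ::
    "('k::field \<Rightarrow> 'l::ab_group_add \<Rightarrow> 'l) \<Rightarrow> ('l \<Rightarrow> 'l \<Rightarrow> 'l) \<Rightarrow>
     ('k \<Rightarrow> 'm::ab_group_add \<Rightarrow> 'm) \<Rightarrow> ('m \<Rightarrow> 'm \<Rightarrow> 'm) \<Rightarrow> bool"
  where "lie_isomorphic s1 br1 s2 br2 \<longleftrightarrow>
    (\<exists>f. Vector_Spaces.linear s1 s2 f \<and> bij f \<and> (\<forall>x y. f (br1 x y) = br2 (f x) (f y)))"

end

theory Submission
  imports Defs
begin

text \<open>If \<open>\<phi>\<close> intertwines \<open>ad e\<close> on \<open>V\<close> with \<open>c \<cdot> ad e'\<close> on \<open>V'\<close>, then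
  \<open>v + a e \<mapsto> \<phi> v + a c e'\<close> is a Lie algebra isomorphism, because the bracket of
  \<open>V \<rtimes> F e\<close> is determined by \<open>ad e\<close> alone (\<open>bracket_semidirect\<close>).

  Conversely, an isomorphism \<open>f\<close> carries \<open>V \<rtimes> F e\<close> to a decomposition \<open>f(V) \<rtimes> F f(e)\<close> of the
  target algebra and intertwines \<open>ad e\<close> with \<open>ad f(e)\<close>. It remains to compare two decompositions
  \<open>W \<rtimes> F x\<close> and \<open>V \<rtimes> F e\<close> of one Lie algebra (\<open>semidirect_similar\<close>). If \<open>W = V\<close>, then \<open>x\<close> is a
  nonzero multiple of \<open>e\<close> modulo \<open>V\<close>, and the identity map intertwines. The Abelian ideal need not
  be unique, however: in the Heisenberg algebra there are many. If \<open>W \<noteq> V\<close>, then \<open>W + V\<close> is the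
  whole algebra, so \<open>W \<inter> V\<close> is central. Choosing \<open>w \<in> W - V\<close> and \<open>u \<in> V - W\<close>, the only
  bracket that matters is \<open>[w, u]\<close>, which lies in \<open>W \<inter> V\<close>. The map that fixes \<open>W \<inter> V\<close> and
  sends \<open>w\<close> to \<open>u\<close> is therefore an intertwiner up to a nonzero factor.\<close>

section \<open>Decompositions along an Abelian ideal of codimension one\<close>

context lie_algebra
begin

lemma bracket_anticomm: "bracket y x = - bracket x y"
proof -
  have "bracket y x + bracket x y = 0"
    using bracket_self[of "x + y", unfolded bracket_add_left bracket_add_right]
    by (simp add: bracket_self)
  then show ?thesis by (simp add: eq_neg_iff_add_eq_0)
qed

text \<open>Codimension one and directness of the sum follow from \<open>e \<notin> V\<close> and spanning, which is
  the form in which decompositions are easy to transport and to modify.\<close>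

lemma semidirect_decomposition_iff:
  "semidirect_decomposition V e \<longleftrightarrow>
    lie_ideal V \<and> abelian V \<and> e \<notin> V \<and> (\<forall>y. \<exists>v\<in>V. \<exists>a. y = v + scale a e)"
  (is "?L \<longleftrightarrow> ?R")
proof
  assume ?L
  then have sum: "{v + w | v w. v \<in> V \<and> w \<in> span {e}} = UNIV"
    by (simp add: semidirect_decomposition_def direct_sum_decomposition_def)
  have "\<exists>v\<in>V. \<exists>a. y = v + scale a e" for y
  proof -
    have "y \<in> {v + w | v w. v \<in> V \<and> w \<in> span {e}}" using sum by simp
    then show ?thesis by (auto simp: span_singleton)
  qed
  with \<open>?L\<close> show ?R by (simp add: semidirect_decomposition_def)
next
  assume R: ?R
  then have V: "subspace V" by (simp add: lie_ideal_def)
  have e: "e \<noteq> 0" using R subspace_0[OF V] by auto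
  have "a = 0" if "scale a e \<in> V" for a
  proof (rule ccontr)
    assume "a \<noteq> 0"
    moreover have "scale (inverse a) (scale a e) \<in> V" using V that by (rule subspace_scale)
    ultimately show False using R by simp
  qed
  then have "V \<inter> span {e} = {0}"
    using subspace_0[OF V] by (auto simp: span_singleton intro: exI[of _ 0])
  moreover have "{v + w | v w. v \<in> V \<and> w \<in> span {e}} = UNIV"
    using R by (auto simp: span_singleton) blast
  ultimately have "direct_sum_decomposition V (span {e})"
    using V by (simp add: direct_sum_decomposition_def)
  moreover have "dim (span {e}) = 1"
    using dim_eq_card_independent[of "{e}"] e by (simp add: dim_span)
  ultimately show ?L
    using R by (auto simp: semidirect_decomposition_def codimension_one_def)
qed

lemma semidirectD:
  assumes "semidirect_decomposition V e"
  shows "lie_ideal V" "abelian V" "subspace V" "e \<notin> V"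
  using assms by (auto simp: semidirect_decomposition_iff lie_ideal_def)

lemma semidirectE:
  assumes "semidirect_decomposition V e"
  obtains v a where "v \<in> V" "y = v + scale a e"
  using assms by (meson semidirect_decomposition_iff)

lemma semidirect_change_complement:
  assumes V: "semidirect_decomposition V e" and u: "u \<notin> V"
  shows "semidirect_decomposition V u"
proof -
  note sub = semidirectD(3)[OF V]
  obtain v a where v: "v \<in> V" and uv: "u = v + scale a e" using V by (rule semidirectE)
  have a: "a \<noteq> 0" using u v uv by auto
  have "\<exists>w\<in>V. \<exists>d. y = w + scale d u" for y
  proof -
    obtain w b where w: "w \<in> V" and y: "y = w + scale b e" using V by (rule semidirectE)
    have "y = (w - scale (b / a) v) + scale (b / a) u"
      using a by (simp add: y uv scale_right_distrib)
    moreover have "w - scale (b / a) v \<in> V"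
      using sub w v by (intro subspace_diff subspace_scale)
    ultimately show ?thesis by blast
  qed
  then show ?thesis
    using V u by (simp add: semidirect_decomposition_iff)
qed

text \<open>The linear functional with kernel \<open>V\<close> and value 1 at \<open>e\<close>.\<close>

definition coord :: "'l set \<Rightarrow> 'l \<Rightarrow> 'l \<Rightarrow> 'k"
  where "coord V e y = (THE a. y - scale a e \<in> V)"

lemma coord_eqI:
  assumes V: "semidirect_decomposition V e" and a: "y - scale a e \<in> V"
  shows "coord V e y = a"
  unfolding coord_def
proof (rule the_equality)
  fix b assume b: "y - scale b e \<in> V"
  note sub = semidirectD(3)[OF V]
  have "(y - scale a e) - (y - scale b e) \<in> V" using sub a b by (rule subspace_diff)
  then have "scale (b - a) e \<in> V" by (simp add: scale_left_diff_distrib)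
  then have "scale (inverse (b - a)) (scale (b - a) e) \<in> V" by (rule subspace_scale[OF sub])
  then show "b = a" using semidirectD(4)[OF V] by (cases "b = a") auto
qed (rule a)

lemma coord_sum:
  assumes "semidirect_decomposition V e" and "v \<in> V"
  shows "coord V e (v + scale a e) = a"
  using assms by (intro coord_eqI) auto

lemma diff_coord_mem:
  assumes V: "semidirect_decomposition V e"
  shows "y - scale (coord V e y) e \<in> V"
proof -
  obtain v a where "v \<in> V" "y = v + scale a e" using V by (rule semidirectE)
  then show ?thesis using coord_sum[OF V] by simp
qed

lemma coord_add:
  assumes V: "semidirect_decomposition V e"
  shows "coord V e (x + y) = coord V e x + coord V e y"
proof (rule coord_eqI[OF V])
  have "(x - scale (coord V e x) e) + (y - scale (coord V e y) e) \<in> V"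
    using V by (intro subspace_add semidirectD(3) diff_coord_mem)
  then show "x + y - scale (coord V e x + coord V e y) e \<in> V"
    by (simp add: scale_left_distrib algebra_simps)
qed

lemma coord_scale:
  assumes V: "semidirect_decomposition V e"
  shows "coord V e (scale c x) = c * coord V e x"
proof (rule coord_eqI[OF V])
  have "scale c (x - scale (coord V e x) e) \<in> V"
    using V by (intro subspace_scale semidirectD(3) diff_coord_mem)
  then show "scale c x - scale (c * coord V e x) e \<in> V"
    by (simp add: scale_right_diff_distrib)
qed

lemma bracket_semidirect:
  assumes "semidirect_decomposition V e" and "v \<in> V" and "w \<in> V"
  shows "bracket (v + scale a e) (w + scale b e)
    = scale a (bracket e w) + scale (- b) (bracket e v)"
proof -
  have "bracket v w = 0" using assms semidirectD(2) by (auto simp: abelian_def)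
  moreover have "bracket v e = - bracket e v" by (rule bracket_anticomm)
  ultimately show ?thesis
    by (simp add: bracket_add_left bracket_add_right bracket_scale_left bracket_scale_right
        bracket_self scale_minus_left scale_minus_right)
qed

section \<open>Comparing two decompositions of one algebra\<close>

lemma semidirect_not_subset:
  assumes W: "semidirect_decomposition W x" and V: "semidirect_decomposition V e"
    and "W \<noteq> V"
  shows "\<not> V \<subseteq> W"
proof
  assume VW: "V \<subseteq> W"
  then obtain u where u: "u \<in> W" "u \<notin> V" using \<open>W \<noteq> V\<close> by blast
  then have U: "semidirect_decomposition V u" using V by (blast intro: semidirect_change_complement)
  obtain v a where "v \<in> V" "x = v + scale a u" using U by (rule semidirectE)
  then have "x \<in> W"
    using u VW semidirectD(3)[OF W] by (auto intro: subspace_add subspace_scale)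
  then show False using semidirectD(4)[OF W] by simp
qed

text \<open>Elements of \<open>W \<inter> V\<close> commute with both Abelian ideals, which together span everything.\<close>

lemma inter_central:
  assumes W: "semidirect_decomposition W x" and V: "semidirect_decomposition V w"
    and w: "w \<in> W" and z: "z \<in> W" "z \<in> V"
  shows "bracket y z = 0"
proof -
  obtain v a where "v \<in> V" "y = v + scale a w" using V by (rule semidirectE)
  then show ?thesis
    using w z semidirectD(2)[OF W] semidirectD(2)[OF V]
    by (simp add: abelian_def bracket_add_left bracket_scale_left)
qed

text \<open>The shear \<open>y \<mapsto> y + a(y) (u - w)\<close>, where \<open>a\<close> is the functional with kernel \<open>V\<close> and
  \<open>a(w) = 1\<close>, fixes \<open>W \<inter> V\<close>, sends \<open>w\<close> to \<open>u\<close>, and hence maps \<open>W = (W \<inter> V) + F w\<close> onto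
  \<open>V = (W \<inter> V) + F u\<close>.\<close>

lemma exchange_bij:
  assumes W: "semidirect_decomposition W u" and V: "semidirect_decomposition V w"
    and w: "w \<in> W" and u: "u \<in> V"
  shows "bij_betw (\<lambda>y. y + scale (coord V w y) (u - w)) W V"
proof -
  have into: "y + scale (coord B p y) (q - p) \<in> B"
    and undo: "(y + scale (coord B p y) (q - p))
      + scale (coord A q (y + scale (coord B p y) (q - p))) (p - q) = y"
    if A: "semidirect_decomposition A q" and B: "semidirect_decomposition B p"
      and p: "p \<in> A" and q: "q \<in> B" and y: "y \<in> A" for A B p q y
  proof -
    have "(y - scale (coord B p y) p) + scale (coord B p y) q \<in> B"
      using B q by (intro subspace_add subspace_scale semidirectD(3) diff_coord_mem)
    then show "y + scale (coord B p y) (q - p) \<in> B"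
      by (simp add: scale_right_diff_distrib algebra_simps)
    have "y - scale (coord B p y) p \<in> A"
      using y p A by (intro subspace_diff subspace_scale semidirectD(3))
    then have "coord A q (y + scale (coord B p y) (q - p)) = coord B p y"
      by (intro coord_eqI[OF A]) (simp add: scale_right_diff_distrib algebra_simps)
    then show "(y + scale (coord B p y) (q - p))
      + scale (coord A q (y + scale (coord B p y) (q - p))) (p - q) = y"
      by (simp add: scale_right_diff_distrib)
  qed
  \<comment> \<open>The inverse is the same shear with the two ideals exchanged.\<close>
  show ?thesis
    by (rule bij_betw_byWitness[where f' = "\<lambda>y. y + scale (coord W u y) (w - u)"])
      (use into[OF W V w u] undo[OF W V w u] into[OF V W u w] undo[OF V W u w] in auto)
qed

text \<open>This makes the classification independent of the choice of the Abelian ideal. For distinct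
  ideals it holds because \<open>ad x\<close> on \<open>W\<close> and \<open>ad e\<close> on \<open>V\<close> both vanish on the central subspace
  \<open>W \<inter> V\<close> and both take values in the multiples of \<open>[w, u]\<close>, which the shear of
  \<open>exchange_bij\<close> fixes pointwise.\<close>

lemma semidirect_similar:
  assumes W: "semidirect_decomposition W x" and V: "semidirect_decomposition V e"
  shows "\<exists>c. c \<noteq> 0 \<and> similar_operators scale W (ad x) scale V (\<lambda>v. scale c (ad e v))"
proof (cases "W = V")
  case True
  obtain v c where v: "v \<in> V" and x: "x = v + scale c e" using V by (rule semidirectE)
  have "c \<noteq> 0" using v x True semidirectD(4)[OF W] by auto
  moreover have "ad x y = scale c (ad e y)" if "y \<in> V" for y
    using v that semidirectD(2)[OF V]
    by (simp add: x ad_def abelian_def bracket_add_left bracket_scale_left)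
  ultimately show ?thesis
    using True unfolding similar_operators_def linear_on_def
    by (intro exI[of _ c] conjI exI[of _ "\<lambda>y. y"]) (auto simp: bij_betw_def)
next
  case False
  obtain u where u: "u \<in> V" "u \<notin> W" using semidirect_not_subset[OF W V] False by blast
  obtain w where w: "w \<in> W" "w \<notin> V" using semidirect_not_subset[OF V W] False by blast
  have Wu: "semidirect_decomposition W u" using W u(2) by (rule semidirect_change_complement)
  have Vw: "semidirect_decomposition V w" using V w(2) by (rule semidirect_change_complement)
  obtain w1 b where w1: "w1 \<in> W" and x: "x = w1 + scale b u" using Wu by (rule semidirectE)
  obtain v1 d where v1: "v1 \<in> V" and e: "e = v1 + scale d w" using Vw by (rule semidirectE)
  have b: "b \<noteq> 0" using w1 x semidirectD(4)[OF W] by auto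
  have d: "d \<noteq> 0" using v1 e semidirectD(4)[OF V] by auto
  define a where "a = coord V w"
  define \<phi> where "\<phi> = (\<lambda>y. y + scale (a y) (u - w))"
  have ad_x: "bracket x y = scale b (bracket u y)" if "y \<in> W" for y
    using that w1 semidirectD(2)[OF W]
    by (simp add: x abelian_def bracket_add_left bracket_scale_left)
  have ad_e: "bracket e y = scale d (bracket w y)" if "y \<in> V" for y
    using that v1 semidirectD(2)[OF V]
    by (simp add: e abelian_def bracket_add_left bracket_scale_left)
  have "linear_on scale scale W \<phi>"
    by (auto simp: linear_on_def \<phi>_def a_def coord_add[OF Vw] coord_scale[OF Vw]
        scale_left_distrib scale_right_distrib)
  moreover have bij: "bij_betw \<phi> W V"
    unfolding \<phi>_def a_def using Wu Vw w(1) u(1) by (rule exchange_bij)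
  \<comment> \<open>\<open>ad x\<close> sends \<open>w\<close> to \<open>b [u, w]\<close>, while \<open>ad e\<close> sends \<open>u\<close> to \<open>d [w, u]\<close>; hence the factor
    \<open>- b / d\<close>.\<close>
  moreover have "\<phi> (ad x y) = scale (- (b / d)) (ad e (\<phi> y))" if y: "y \<in> W" for y
  proof -
    define z where "z = y - scale (a y) w"
    have y_eq: "y = z + scale (a y) w" and phi_eq: "\<phi> y = z + scale (a y) u"
      by (simp_all add: z_def \<phi>_def scale_right_diff_distrib)
    have z: "z \<in> W" "z \<in> V"
      using diff_coord_mem[OF Vw] y w(1) semidirectD(3)[OF W]
      by (auto simp: z_def a_def intro: subspace_diff subspace_scale)
    have z0: "bracket p z = 0" for p using W Vw w(1) z by (rule inter_central)
    have uy: "bracket u y = scale (a y) (bracket u w)"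
      by (subst y_eq) (simp add: bracket_add_right bracket_scale_right z0)
    have w\<phi>: "bracket w (\<phi> y) = scale (a y) (bracket w u)"
      by (simp add: phi_eq bracket_add_right bracket_scale_right z0)
    have wu: "bracket w u = - bracket u w" by (rule bracket_anticomm)
    have "bracket w u \<in> V" using semidirectD(1)[OF V] u(1) by (simp add: lie_ideal_def)
    then have "bracket u w \<in> V" using subspace_neg[OF semidirectD(3)[OF V]] wu by force
    then have "bracket x y \<in> V"
      using semidirectD(3)[OF V] y by (simp add: ad_x uy subspace_scale)
    then have "a (bracket x y) = 0" unfolding a_def by (intro coord_eqI[OF Vw]) simp
    then have "\<phi> (bracket x y) = scale (b * a y) (bracket u w)"
      using y by (simp add: \<phi>_def ad_x uy)
    moreover have "bracket e (\<phi> y) = - scale (d * a y) (bracket u w)"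
      using bij y by (simp add: ad_e w\<phi> wu scale_minus_right bij_betw_apply)
    ultimately show ?thesis using d by (simp add: ad_def scale_minus_left scale_minus_right)
  qed
  ultimately show ?thesis
    using b d unfolding similar_operators_def
    by (intro exI[of _ "- (b / d)"] conjI exI[of _ \<phi>]) auto
qed

end

section \<open>Isomorphism and similarity\<close>

lemma similar_operators_trans:
  assumes "similar_operators s1 V1 T1 s2 V2 T2" and "similar_operators s2 V2 T2 s3 V3 T3"
  shows "similar_operators s1 V1 T1 s3 V3 T3"
proof -
  obtain \<phi> where p: "linear_on s1 s2 V1 \<phi>" "bij_betw \<phi> V1 V2" "\<forall>v\<in>V1. \<phi> (T1 v) = T2 (\<phi> v)"
    using assms(1) by (auto simp: similar_operators_def)
  obtain \<psi> where q: "linear_on s2 s3 V2 \<psi>" "bij_betw \<psi> V2 V3" "\<forall>v\<in>V2. \<psi> (T2 v) = T3 (\<psi> v)"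
    using assms(2) by (auto simp: similar_operators_def)
  have m: "\<phi> v \<in> V2" if "v \<in> V1" for v using p(2) that by (rule bij_betw_apply)
  have "linear_on s1 s3 V1 (\<psi> \<circ> \<phi>)" using p(1) q(1) m by (auto simp: linear_on_def)
  moreover have "bij_betw (\<psi> \<circ> \<phi>) V1 V3" using p(2) q(2) by (rule bij_betw_trans)
  ultimately show ?thesis
    unfolding similar_operators_def using p(3) q(3) m by (intro exI[of _ "\<psi> \<circ> \<phi>"]) auto
qed

locale lie_algebra_pair =
  L: lie_algebra scale bracket + L': lie_algebra scale' bracket'
  for scale :: "'k::field \<Rightarrow> 'l::ab_group_add \<Rightarrow> 'l" and bracket :: "'l \<Rightarrow> 'l \<Rightarrow> 'l"
    and scale' :: "'k \<Rightarrow> 'm::ab_group_add \<Rightarrow> 'm" and bracket' :: "'m \<Rightarrow> 'm \<Rightarrow> 'm"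
begin

lemma semidirect_image:
  assumes V: "L.semidirect_decomposition V e"
    and lin: "Vector_Spaces.linear scale scale' f" and bij: "bij f"
    and br: "\<And>x y. f (bracket x y) = bracket' (f x) (f y)"
  shows "L'.semidirect_decomposition (f ` V) (f e)"
proof -
  interpret f: Vector_Spaces.linear scale scale' f by (rule lin)
  have surj: "\<exists>x. y = f x" for y using bij by (meson bij_pointE)
  have inj: "f x = f y \<longleftrightarrow> x = y" for x y using bij by (rule inj_eq[OF bij_is_inj])
  have "L'.subspace (f ` V)" using L.semidirectD(3)[OF V] by (rule f.subspace_image)
  moreover have "bracket' x (f v) \<in> f ` V" if "v \<in> V" for x v
    using surj[of x] that L.semidirectD(1)[OF V] by (auto simp: L.lie_ideal_def simp flip: br)
  ultimately have "L'.lie_ideal (f ` V)" by (auto simp: L'.lie_ideal_def)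
  moreover have "L'.abelian (f ` V)"
    using L.semidirectD(2)[OF V] by (auto simp: L.abelian_def L'.abelian_def simp flip: br)
  moreover have "f e \<notin> f ` V" using L.semidirectD(4)[OF V] inj by auto
  moreover have "\<exists>v\<in>f ` V. \<exists>a. y = v + scale' a (f e)" for y
  proof -
    obtain x where y: "y = f x" using surj by blast
    obtain v a where "v \<in> V" "x = v + scale a e" using V by (rule L.semidirectE)
    then show ?thesis using y by (auto simp: f.add f.scale)
  qed
  ultimately show ?thesis by (simp add: L'.semidirect_decomposition_iff)
qed

text \<open>The image of \<open>V\<close> under an isomorphism may differ from \<open>V'\<close>, so the similarity induced by the
  isomorphism is composed with one between the two decompositions of the target algebra.\<close>

lemma isomorphic_imp_similar:
  assumes V: "L.semidirect_decomposition V e" and V': "L'.semidirect_decomposition V' e'"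
    and "lie_isomorphic scale bracket scale' bracket'"
  shows "\<exists>c. c \<noteq> 0 \<and>
    similar_operators scale V (L.ad e) scale' V' (\<lambda>v. scale' c (L'.ad e' v))"
proof -
  obtain f where lin: "Vector_Spaces.linear scale scale' f" and bij: "bij f"
    and br: "\<And>x y. f (bracket x y) = bracket' (f x) (f y)"
    using assms(3) by (auto simp: lie_isomorphic_def)
  interpret f: Vector_Spaces.linear scale scale' f by (rule lin)
  have "linear_on scale scale' V f" by (simp add: linear_on_def f.add f.scale)
  moreover have "bij_betw f V (f ` V)" using bij by (auto simp: bij_betw_def bij_def inj_on_def)
  ultimately have "similar_operators scale V (L.ad e) scale' (f ` V) (L'.ad (f e))"
    unfolding similar_operators_def by (intro exI[of _ f]) (simp add: L.ad_def L'.ad_def br)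
  then show ?thesis
    using L'.semidirect_similar[OF semidirect_image[OF V lin bij br] V']
    by (blast intro: similar_operators_trans)
qed

text \<open>The factor \<open>c\<close> is absorbed by sending \<open>e\<close> to \<open>c e'\<close>; since \<open>c \<noteq> 0\<close>, the map
  \<open>v + a e \<mapsto> \<phi> v + a c e'\<close> remains bijective.\<close>

lemma similar_imp_isomorphic:
  assumes V: "L.semidirect_decomposition V e" and V': "L'.semidirect_decomposition V' e'"
    and c: "c \<noteq> 0"
    and "similar_operators scale V (L.ad e) scale' V' (\<lambda>v. scale' c (L'.ad e' v))"
  shows "lie_isomorphic scale bracket scale' bracket'"
proof -
  obtain \<phi> where lin: "linear_on scale scale' V \<phi>" and bij: "bij_betw \<phi> V V'"
    and tw: "\<And>v. v \<in> V \<Longrightarrow> \<phi> (bracket e v) = scale' c (bracket' e' (\<phi> v))"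
    using assms(4) by (auto simp: similar_operators_def L.ad_def L'.ad_def)
  note sub = L.semidirectD(3)[OF V]
  have add: "\<phi> (v + w) = \<phi> v + \<phi> w" and scl: "\<phi> (scale b v) = scale' b (\<phi> v)"
    if "v \<in> V" "w \<in> V" for v w b
    using lin that by (auto simp: linear_on_def)
  have mem: "\<phi> v \<in> V'" if "v \<in> V" for v using bij that by (rule bij_betw_apply)
  have ideal: "bracket e v \<in> V" if "v \<in> V" for v
    using L.semidirectD(1)[OF V] that by (simp add: L.lie_ideal_def)
  define a where "a = L.coord V e"
  define f where "f = (\<lambda>y. \<phi> (y - scale (a y) e) + scale' (a y * c) e')"
  have f_eq: "f (v + scale b e) = \<phi> v + scale' (b * c) e'" if "v \<in> V" for v b
    using L.coord_sum[OF V that] by (simp add: f_def a_def)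
  have "f (x + y) = f x + f y" and "f (scale k x) = scale' k (f x)"
    and br: "f (bracket x y) = bracket' (f x) (f y)"
    and inj: "f x = f y \<Longrightarrow> x = y" for x y k
  proof -
    obtain v p where v: "v \<in> V" and x: "x = v + scale p e" using V by (rule L.semidirectE)
    obtain w q where w: "w \<in> V" and y: "y = w + scale q e" using V by (rule L.semidirectE)
    have "x + y = (v + w) + scale (p + q) e" by (simp add: x y L.scale_left_distrib)
    then have "f (x + y) = \<phi> (v + w) + scale' ((p + q) * c) e'"
      using f_eq L.subspace_add[OF sub v w] by simp
    then show "f (x + y) = f x + f y"
      by (simp add: x y f_eq v w add distrib_right L'.scale_left_distrib)
    have "scale k x = scale k v + scale (k * p) e" by (simp add: x L.scale_right_distrib)
    then have "f (scale k x) = \<phi> (scale k v) + scale' (k * p * c) e'"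
      using f_eq L.subspace_scale[OF sub v] by simp
    then show "f (scale k x) = scale' k (f x)"
      by (simp add: x f_eq v scl[OF v v] L'.scale_right_distrib mult.assoc)
    let ?r = "scale p (bracket e w) + scale (- q) (bracket e v)"
    have pw: "scale p (bracket e w) \<in> V" and qv: "scale (- q) (bracket e v) \<in> V"
      using sub ideal v w by (auto intro!: L.subspace_scale simp del: L.scale_minus_left)
    have "bracket x y = ?r + scale 0 e"
      using L.bracket_semidirect[OF V v w] by (simp add: x y)
    then have "f (bracket x y) = \<phi> ?r"
      using f_eq[of ?r 0] L.subspace_add[OF sub pw qv] by simp
    also have "\<dots> = scale' p (\<phi> (bracket e w)) + scale' (- q) (\<phi> (bracket e v))"
      using add[OF pw qv] scl[OF ideal[OF w] ideal[OF w]] scl[OF ideal[OF v] ideal[OF v]]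
      by metis
    also have "\<dots> = bracket' (\<phi> v + scale' (p * c) e') (\<phi> w + scale' (q * c) e')"
      using L'.bracket_semidirect[OF V' mem[OF v] mem[OF w]] by (simp add: tw v w)
    finally show "f (bracket x y) = bracket' (f x) (f y)" by (simp add: x y f_eq v w)
    assume "f x = f y"
    then have fxy: "\<phi> v + scale' (p * c) e' = \<phi> w + scale' (q * c) e'"
      by (simp add: x y f_eq v w)
    then have "p * c = q * c"
      using L'.coord_sum[OF V' mem[OF v]] L'.coord_sum[OF V' mem[OF w]] by metis
    then have "p = q" using c by simp
    moreover from this have "v = w"
      using fxy bij v w by (auto simp: bij_betw_def inj_on_def)
    ultimately show "x = y" by (simp add: x y)
  qed
  then have "Vector_Spaces.linear scale scale' f"
    by (intro Vector_Spaces.linear_iff[THEN iffD2] conjI allI L.vector_space_axioms L'.vector_space_axioms)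
  moreover have "\<exists>x. f x = y" for y
  proof -
    obtain v' b where "v' \<in> V'" and y: "y = v' + scale' b e'" using V' by (rule L'.semidirectE)
    then obtain v where "v \<in> V" "v' = \<phi> v" using bij by (auto simp: bij_betw_def)
    then have "f (v + scale (b / c) e) = y" using c by (simp add: f_eq y)
    then show ?thesis by blast
  qed
  then have "bij f" using inj by (metis bijI injI surjI surj_def)
  ultimately show ?thesis using br by (auto simp: lie_isomorphic_def)
qed

end

theorem proposition10:
  fixes scale :: "'k::field \<Rightarrow> 'l::ab_group_add \<Rightarrow> 'l"
    and bracket :: "'l \<Rightarrow> 'l \<Rightarrow> 'l"
    and V :: "'l set" and e0 :: 'l
    and scale' :: "'k \<Rightarrow> 'm::ab_group_add \<Rightarrow> 'm"
    and bracket' :: "'m \<Rightarrow> 'm \<Rightarrow> 'm"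
    and V' :: "'m set" and e0' :: 'm
  assumes "almost_abelian_lie_algebra scale bracket"
    and "lie_algebra.semidirect_decomposition scale bracket V e0"
    and "almost_abelian_lie_algebra scale' bracket'"
    and "lie_algebra.semidirect_decomposition scale' bracket' V' e0'"
  shows "lie_isomorphic scale bracket scale' bracket' \<longleftrightarrow>
    (\<exists>c. c \<noteq> 0 \<and>
      similar_operators scale V (lie_algebra.ad bracket e0)
        scale' V' (\<lambda>v. scale' c (lie_algebra.ad bracket' e0' v)))"
proof -
  interpret A: almost_abelian_lie_algebra scale bracket by (rule assms(1))
  interpret A': almost_abelian_lie_algebra scale' bracket' by (rule assms(3))
  interpret lie_algebra_pair scale bracket scale' bracket' ..
  show ?thesis
    using isomorphic_imp_similar[OF assms(2,4)] similar_imp_isomorphic[OF assms(2,4)] by blast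
qed

end
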